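(* Fix an integer $m\ge1$. (1) Let $\varepsilon\in\left(0,\frac{m}{m+4}\right)$ and $\mu=\lfloor n^{\frac{m}{m+4}-\varepsilon}\rfloor$. With probability tending to $1$ as $n\to\infty$, $G_m^n$ has no maximal recursive tree whose vertex set is contained in $[\mu]=\{1,\dots,\mu\}$. (2) Let $\mu=\mu(n)\to\infty$ with $\mu=o(n)$. With probability tending to $1$ as $n\to\infty$, no subset of $[\mu]$ of cardinality comparable to $\mu$ is the vertex set of a maximal recursive tree of $G_m^n$; that is, for every $\kappa\in(0,1)$, with probability tending to $1$ there is no $A\subset[\mu]$ with $|A|\ge\kappa\mu$ that is the vertex set of a maximal recursive tree of $G_m^n$.
   Context: Bollobás–Riordan preferential attachment multigraph $G_m^n$. Let $w_1,\dots,w_{mn+1}$ be independent exponential random variables with mean $1$, $W_k=\sum_{i=1}^k w_i$, $W_0=0$. Put $R_k=W_k/W_{mn+1}$ for $k=1,\dots,mn$, $R_0=0$. Conditionally on $\mathbf W=\{W_k\}$, let $\ell_1,\dots,\ell_{mn}$ be independent, $\ell_k$ having density $\frac{1}{2\sqrt{R_k x}}$ on $(0,R_k]$. The vertex set of $G_m^n$ is $[n]$; vertex $j$ is identified with the interval $(R_{m(j-1)},R_{mj}]$. For each $k\in[mn]$ there is one edge joining the vertex containing $R_k$ with the vertex containing $\ell_k$ (a loop if these coincide). For vertices $a<b$ we say $b$ selects $a$ if one of the left endpoints $\ell_{m(b-1)+1},\dots,\ell_{mb}$ lies in the interval of $a$ (equivalently $(a,b)$ is an edge). A recursive tree in $G_m^n$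 is a subgraph $T$ that is a tree rooted at its smallest vertex such that vertex labels increase along every path going away from the root (a single vertex is allowed). $T$ is maximal if no vertex outside $V(T)$ selects a vertex in $V(T)$. *)

theory Defs
  imports "HOL-Probability.Probability" "HOL-Library.Landau_Symbols"
begin

definition W :: "(nat \<Rightarrow> real) \<Rightarrow> nat \<Rightarrow> real" where
  "W w k = (\<Sum>i=1..k. w i)"

definition R :: "nat \<Rightarrow> nat \<Rightarrow> (nat \<Rightarrow> real) \<Rightarrow> nat \<Rightarrow> real" where
  "R m n w k = W w k / W w (m * n + 1)"

definition left_density :: "real \<Rightarrow> real \<Rightarrow> real" where
  "left_density r x = (if 0 < x \<and> x \<le> r then 1 / (2 * sqrt (r * x)) else 0)"

definition weight_law :: "nat \<Rightarrow> nat \<Rightarrow> (nat \<Rightarrow> real) measure" where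
  "weight_law m n = PiM {1..m * n + 1} (\<lambda>_. density lborel (exponential_density 1))"

text \<open>The conditional law of the left endpoints given the weights: a product measure, i.e.
  (conditional) independence.\<close>

definition left_law :: "nat \<Rightarrow> nat \<Rightarrow> (nat \<Rightarrow> real) \<Rightarrow> (nat \<Rightarrow> real) measure" where
  "left_law m n w = PiM {1..m * n} (\<lambda>k. density lborel (left_density (R m n w k)))"

definition BR_algebra :: "nat \<Rightarrow> nat \<Rightarrow> ((nat \<Rightarrow> real) \<times> (nat \<Rightarrow> real)) measure" where
  "BR_algebra m n = PiM {1..m * n + 1} (\<lambda>_. borel) \<Otimes>\<^sub>M PiM {1..m * n} (\<lambda>_. borel)"

text \<open>The joint law of the weights and the left endpoints. An outcome \<open>(w, l)\<close> determines the
  multigraph completely. For the null set of weight vectors with \<open>R m n w k \<le> 0\<close> for some \<open>k\<close>,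
  \<open>left_law m n w\<close> is the zero measure; \<open>prob_space_BR\<close> below shows that this is harmless.\<close>

definition BR :: "nat \<Rightarrow> nat \<Rightarrow> ((nat \<Rightarrow> real) \<times> (nat \<Rightarrow> real)) measure" where
  "BR m n = weight_law m n \<bind> (\<lambda>w. distr (left_law m n w) (BR_algebra m n) (\<lambda>l. (w, l)))"

definition cell :: "nat \<Rightarrow> nat \<Rightarrow> (nat \<Rightarrow> real) \<Rightarrow> nat \<Rightarrow> real set" where
  "cell m n w j = {R m n w (m * (j - 1)) <.. R m n w (m * j)}"

text \<open>Edges of the multigraph are identified with their indices in \<open>{1..m * n}\<close>, so that parallel
  edges remain distinct.\<close>

definition joins ::
  "nat \<Rightarrow> nat \<Rightarrow> (nat \<Rightarrow> real) \<times> (nat \<Rightarrow> real) \<Rightarrow> nat \<Rightarrow> nat \<Rightarrow> nat \<Rightarrow> bool" where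
  "joins m n \<omega> k a b \<longleftrightarrow> (case \<omega> of (w, l) \<Rightarrow>
     a \<in> {1..n} \<and> b \<in> {1..n} \<and>
     (R m n w k \<in> cell m n w a \<and> l k \<in> cell m n w b \<or>
      R m n w k \<in> cell m n w b \<and> l k \<in> cell m n w a))"

definition selects ::
  "nat \<Rightarrow> nat \<Rightarrow> (nat \<Rightarrow> real) \<times> (nat \<Rightarrow> real) \<Rightarrow> nat \<Rightarrow> nat \<Rightarrow> bool" where
  "selects m n \<omega> b a \<longleftrightarrow> (case \<omega> of (w, l) \<Rightarrow>
     a \<in> {1..n} \<and> b \<in> {1..n} \<and> a < b \<and>
     (\<exists>k\<in>{m * (b - 1) + 1..m * b}. l k \<in> cell m n w a))"

text \<open>A subgraph is given by its vertex set \<open>V\<close> and its set \<open>E\<close> of edge indices.\<close>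

definition is_subgraph ::
  "nat \<Rightarrow> nat \<Rightarrow> (nat \<Rightarrow> real) \<times> (nat \<Rightarrow> real) \<Rightarrow> nat set \<Rightarrow> nat set \<Rightarrow> bool" where
  "is_subgraph m n \<omega> V E \<longleftrightarrow>
     V \<subseteq> {1..n} \<and> E \<subseteq> {1..m * n} \<and> (\<forall>k\<in>E. \<exists>a\<in>V. \<exists>b\<in>V. joins m n \<omega> k a b)"

text \<open>In \<open>walk J E u p v\<close>, \<open>J k a b\<close> says that edge \<open>k\<close> joins \<open>a\<close> and \<open>b\<close>, and \<open>p\<close> lists the
  successive edges used by a walk from \<open>u\<close> to \<open>v\<close>, each paired with the vertex it leads to.\<close>

fun walk ::
  "('e \<Rightarrow> 'v \<Rightarrow> 'v \<Rightarrow> bool) \<Rightarrow> 'e set \<Rightarrow> 'v \<Rightarrow> ('e \<times> 'v) list \<Rightarrow> 'v \<Rightarrow> bool" where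
  "walk J E u [] v \<longleftrightarrow> u = v"
| "walk J E u ((k, x) # p) v \<longleftrightarrow> k \<in> E \<and> J k u x \<and> walk J E x p v"

definition is_path ::
  "('e \<Rightarrow> 'v \<Rightarrow> 'v \<Rightarrow> bool) \<Rightarrow> 'e set \<Rightarrow> 'v \<Rightarrow> ('e \<times> 'v) list \<Rightarrow> 'v \<Rightarrow> bool" where
  "is_path J E u p v \<longleftrightarrow> walk J E u p v \<and> distinct (u # map snd p)"

text \<open>Loops and pairs of parallel edges are cycles, of length 1 and 2.\<close>

definition is_cycle ::
  "('e \<Rightarrow> 'v \<Rightarrow> 'v \<Rightarrow> bool) \<Rightarrow> 'e set \<Rightarrow> 'v \<Rightarrow> ('e \<times> 'v) list \<Rightarrow> bool" where
  "is_cycle J E u p \<longleftrightarrow>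
     walk J E u p u \<and> p \<noteq> [] \<and> distinct (map fst p) \<and> distinct (map snd p)"

definition is_tree :: "('e \<Rightarrow> 'v \<Rightarrow> 'v \<Rightarrow> bool) \<Rightarrow> 'v set \<Rightarrow> 'e set \<Rightarrow> bool" where
  "is_tree J V E \<longleftrightarrow> V \<noteq> {} \<and> (\<forall>u\<in>V. \<forall>v\<in>V. \<exists>p. walk J E u p v) \<and>
     (\<nexists>u p. is_cycle J E u p)"

definition recursive_tree ::
  "nat \<Rightarrow> nat \<Rightarrow> (nat \<Rightarrow> real) \<times> (nat \<Rightarrow> real) \<Rightarrow> nat set \<Rightarrow> nat set \<Rightarrow> bool" where
  "recursive_tree m n \<omega> V E \<longleftrightarrow>
     is_subgraph m n \<omega> V E \<and> is_tree (joins m n \<omega>) V E \<and>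
     (\<forall>p v. is_path (joins m n \<omega>) E (Min V) p v \<longrightarrow> sorted_wrt (<) (Min V # map snd p))"

definition maximal_recursive_tree ::
  "nat \<Rightarrow> nat \<Rightarrow> (nat \<Rightarrow> real) \<times> (nat \<Rightarrow> real) \<Rightarrow> nat set \<Rightarrow> nat set \<Rightarrow> bool" where
  "maximal_recursive_tree m n \<omega> V E \<longleftrightarrow>
     recursive_tree m n \<omega> V E \<and> (\<forall>b\<in>{1..n} - V. \<forall>a\<in>V. \<not> selects m n \<omega> b a)"


lemma left_density_nonneg: "0 \<le> left_density r x"
  by (simp add: left_density_def)

lemma borel_measurable_left_density [measurable]:
  "(\<lambda>x. left_density (f x) (g x)) \<in> borel_measurable M"
  if [measurable]: "f \<in> borel_measurable M" "g \<in> borel_measurable M"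
  unfolding left_density_def by measurable

lemma nn_integral_left_density:
  assumes "0 < r"
  shows "(\<integral>\<^sup>+x. ennreal (left_density r x) \<partial>lborel) = 1"
proof -
  let ?F = "\<lambda>x. sqrt (x / r)" and ?f = "\<lambda>x. 1 / (2 * sqrt (r * x))"
  have D: "(?F has_real_derivative ?f x) (at x)" if "0 < x" for x
    using assms that
    by (auto intro!: derivative_eq_intros simp: field_simps real_sqrt_mult real_sqrt_divide)
  have cont: "isCont ?f x" if "0 < x" for x
    using assms that by (auto intro!: continuous_intros)
  have "((?F \<circ> real_of_ereal) \<longlongrightarrow> 0) (at_right (ereal 0))"
    unfolding ereal_tendsto_simps using assms by (auto intro!: tendsto_eq_intros)
  moreover have "((?F \<circ> real_of_ereal) \<longlongrightarrow> 1) (at_left (ereal r))"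
    unfolding ereal_tendsto_simps using assms by (auto intro!: tendsto_eq_intros)
  moreover have pos: "AE x in lborel. ereal 0 < ereal x \<longrightarrow> ereal x < ereal r \<longrightarrow> 0 \<le> ?f x"
    using assms by (intro AE_I2) (auto simp: less_imp_le)
  ultimately have int: "set_integrable lborel {0<..<r} ?f"
    and val: "(LBINT x=ereal 0..ereal r. ?f x) = 1 - 0"
    using interval_integral_FTC_nonneg[of "ereal 0" "ereal r" ?F ?f 0 1] assms D cont
    by auto
  have eq: "left_density r x = indicator {0<..<r} x * ?f x" if "x \<noteq> r" for x
    using that by (cases "0 < x"; cases "x < r") (simp_all add: left_density_def)
  have "(\<integral>\<^sup>+x. ennreal (left_density r x) \<partial>lborel)
      = (\<integral>\<^sup>+x. ennreal (indicator {0<..<r} x * ?f x) \<partial>lborel)"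
    by (rule nn_integral_cong_AE, rule AE_mp[OF AE_lborel_singleton[of r]])
      (rule AE_I2, rule impI, simp add: eq)
  also have "\<dots> = ennreal (LINT x|lborel. indicator {0<..<r} x * ?f x)"
  proof (rule nn_integral_eq_integral)
    show "integrable lborel (\<lambda>x. indicator {0<..<r} x * ?f x)"
      using int unfolding set_integrable_def by simp
    show "AE x in lborel. 0 \<le> indicator {0<..<r} x * ?f x"
      using assms by (intro AE_I2) (simp add: indicator_def)
  qed
  also have "(LINT x|lborel. indicator {0<..<r} x * ?f x) = 1"
    using val assms
    by (simp add: interval_lebesgue_integral_def set_lebesgue_integral_def)
  finally show ?thesis by simp
qed

lemma left_density_eq_0: "r \<le> 0 \<Longrightarrow> left_density r = (\<lambda>_. 0)"
  by (auto simp: left_density_def)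

lemma subprob_space_left_density: "subprob_space (density lborel (left_density r))"
proof (cases "0 < r")
  case True
  then show ?thesis
    by (intro prob_space_imp_subprob_space prob_spaceI)
      (simp add: emeasure_density nn_integral_left_density)
next
  case False
  then show ?thesis
    by (intro subprob_spaceI) (auto simp: emeasure_density left_density_eq_0)
qed

lemma sets_left_law [measurable_cong]: "sets (left_law m n w) = sets (PiM {1..m * n} (\<lambda>_. borel))"
  unfolding left_law_def by (intro sets_PiM_cong) auto

lemma sets_weight_law [measurable_cong]:
  "sets (weight_law m n) = sets (PiM {1..m * n + 1} (\<lambda>_. borel))"
  unfolding weight_law_def by (intro sets_PiM_cong) auto

lemma prob_space_weight_law: "prob_space (weight_law m n)"
  unfolding weight_law_def by (intro prob_space_PiM prob_space_exponential_density) simp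

lemma left_law_eq_density:
  "left_law m n w = density (PiM {1..m * n} (\<lambda>_. lborel))
     (\<lambda>l. \<Prod>k\<in>{1..m * n}. ennreal (left_density (R m n w k) (l k)))"
proof -
  interpret P: product_sigma_finite "\<lambda>k. density lborel (left_density (R m n w k))"
    by (intro product_sigma_finite.intro finite_measure.sigma_finite_measure
      subprob_space.axioms(1) subprob_space_left_density)
  interpret L: product_sigma_finite "\<lambda>_::nat. lborel :: real measure"
    by standard
  show ?thesis
    unfolding left_law_def
  proof (rule P.PiM_eqI [symmetric])
    fix A :: "nat \<Rightarrow> real set"
    assume A: "\<And>i. i \<in> {1..m * n} \<Longrightarrow> A i \<in> sets (density lborel (left_density (R m n w i)))"
    have [measurable]: "A i \<in> sets borel" if "i \<in> {1..m * n}" for i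
      using A[OF that] by simp
    have "emeasure (density (PiM {1..m * n} (\<lambda>_. lborel))
          (\<lambda>l. \<Prod>k\<in>{1..m * n}. ennreal (left_density (R m n w k) (l k)))) (PiE {1..m * n} A)
        = (\<integral>\<^sup>+l. (\<Prod>k\<in>{1..m * n}. ennreal (left_density (R m n w k) (l k)))
             * indicator (PiE {1..m * n} A) l \<partial>PiM {1..m * n} (\<lambda>_. lborel))"
      by (intro emeasure_density) auto
    also have "\<dots> = (\<integral>\<^sup>+l. (\<Prod>k\<in>{1..m * n}. ennreal (left_density (R m n w k) (l k))
             * indicator (A k) (l k)) \<partial>PiM {1..m * n} (\<lambda>_. lborel))"
    proof (rule nn_integral_cong)
      fix l :: "nat \<Rightarrow> real" assume l: "l \<in> space (PiM {1..m * n} (\<lambda>_. lborel :: real measure))"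
      have "indicator (PiE {1..m * n} A) l = (\<Prod>k\<in>{1..m * n}. indicator (A k) (l k) :: ennreal)"
      proof (cases "l \<in> PiE {1..m * n} A")
        case True
        then show ?thesis by (auto simp: PiE_mem)
      next
        case False
        then obtain k where "k \<in> {1..m * n}" "l k \<notin> A k"
          using l by (auto simp: space_PiM PiE_iff)
        then show ?thesis using False by (subst prod_zero) (auto intro!: bexI[of _ k])
      qed
      then show "(\<Prod>k\<in>{1..m * n}. ennreal (left_density (R m n w k) (l k)))
             * indicator (PiE {1..m * n} A) l
          = (\<Prod>k\<in>{1..m * n}. ennreal (left_density (R m n w k) (l k)) * indicator (A k) (l k))"
        by (simp add: prod.distrib)
    qed
    also have "\<dots> = (\<Prod>k\<in>{1..m * n}.
        \<integral>\<^sup>+x. ennreal (left_density (R m n w k) x) * indicator (A k) x \<partial>lborel)"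
      by (intro L.product_nn_integral_prod) auto
    also have "\<dots> = (\<Prod>k\<in>{1..m * n}. emeasure (density lborel (left_density (R m n w k))) (A k))"
      by (intro prod.cong refl) (simp add: emeasure_density)
    finally show "emeasure (density (PiM {1..m * n} (\<lambda>_. lborel))
          (\<lambda>l. \<Prod>k\<in>{1..m * n}. ennreal (left_density (R m n w k) (l k)))) (PiE {1..m * n} A)
        = (\<Prod>k\<in>{1..m * n}. emeasure (density lborel (left_density (R m n w k))) (A k))" .
  qed (auto intro!: sets_PiM_cong)
qed

lemma emeasure_left_law_space:
  "emeasure (left_law m n w) (space (left_law m n w)) =
     (\<Prod>k\<in>{1..m * n}. emeasure (density lborel (left_density (R m n w k))) UNIV)"
proof -
  interpret P: product_sigma_finite "\<lambda>k. density lborel (left_density (R m n w k))"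
    by (intro product_sigma_finite.intro finite_measure.sigma_finite_measure
      subprob_space.axioms(1) subprob_space_left_density)
  show ?thesis
    unfolding left_law_def space_PiM by (subst P.emeasure_PiM) auto
qed

lemma subprob_space_left_law: "subprob_space (left_law m n w)"
proof (rule subprob_spaceI)
  show "emeasure (left_law m n w) (space (left_law m n w)) \<le> 1"
    unfolding emeasure_left_law_space
    using subprob_space.subprob_emeasure_le_1[OF subprob_space_left_density]
    by (intro prod_le_1) auto
  show "space (left_law m n w) \<noteq> {}"
    by (auto simp: left_law_def space_PiM PiE_eq_empty_iff)
qed

lemma prob_space_left_law:
  assumes "\<And>k. k \<in> {1..m * n} \<Longrightarrow> 0 < R m n w k"
  shows "prob_space (left_law m n w)"
proof (rule prob_spaceI)
  show "emeasure (left_law m n w) (space (left_law m n w)) = 1"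
    unfolding emeasure_left_law_space
    by (intro prod.neutral ballI) (simp add: emeasure_density nn_integral_left_density assms)
qed

lemma measurable_R [measurable]:
  assumes "k \<in> {0..m * n + 1}"
  shows "(\<lambda>w. R m n w k) \<in> borel_measurable (PiM {1..m * n + 1} (\<lambda>_. borel))"
  using assms unfolding R_def W_def
  by (intro borel_measurable_divide borel_measurable_sum measurable_component_singleton) auto

lemma measurable_left_law:
  "left_law m n \<in> weight_law m n \<rightarrow>\<^sub>M subprob_algebra (PiM {1..m * n} (\<lambda>_. borel))"
proof (rule measurable_subprob_algebra)
  interpret L: product_sigma_finite "\<lambda>_::nat. lborel :: real measure"
    by standard
  interpret sigma_finite_measure "PiM {1..m * n} (\<lambda>_. lborel :: real measure)"
    by (rule L.sigma_finite) simp
  have [measurable_cong]: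
    "sets (PiM {1..m * n} (\<lambda>_. lborel :: real measure)) = sets (PiM {1..m * n} (\<lambda>_. borel))"
    by (intro sets_PiM_cong) auto
  fix A assume [measurable]: "A \<in> sets (PiM {1..m * n} (\<lambda>_. borel :: real measure))"
  have "(\<lambda>w. emeasure (left_law m n w) A) = (\<lambda>w. \<integral>\<^sup>+l.
      (\<Prod>k\<in>{1..m * n}. ennreal (left_density (R m n w k) (l k))) * indicator A l
        \<partial>PiM {1..m * n} (\<lambda>_. lborel))"
    unfolding left_law_eq_density by (intro ext emeasure_density) measurable
  also have "\<dots> \<in> borel_measurable (weight_law m n)"
    by measurable
  finally show "(\<lambda>w. emeasure (left_law m n w) A) \<in> borel_measurable (weight_law m n)" .
qed (auto simp: subprob_space_left_law sets_left_law)

lemma measurable_BR_kernel: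
  "(\<lambda>w. distr (left_law m n w) (BR_algebra m n) (\<lambda>l. (w, l)))
     \<in> weight_law m n \<rightarrow>\<^sub>M subprob_algebra (BR_algebra m n)"
  proof (rule measurable_distr2[OF _ measurable_left_law])
  have id: "(\<lambda>(w :: nat \<Rightarrow> real, l :: nat \<Rightarrow> real). (w, l)) = (\<lambda>x. x)"
    by auto
  show "(\<lambda>(w, l). (w, l)) \<in> weight_law m n \<Otimes>\<^sub>M PiM {1..m * n} (\<lambda>_. borel) \<rightarrow>\<^sub>M BR_algebra m n"
    unfolding id BR_algebra_def
    by (intro measurable_ident_sets sets_pair_measure_cong sets_weight_law refl)
qed

lemma AE_weight_law_pos: "AE w in weight_law m n. \<forall>i\<in>{1..m * n + 1}. 0 < w i"
proof (intro AE_finite_allI)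
  interpret P: product_prob_space "\<lambda>_::nat. density lborel (exponential_density 1)"
    "{1..m * n + 1}"
    by (intro product_prob_spaceI prob_space_exponential_density) simp
  fix i assume i: "i \<in> {1..m * n + 1}"
  have "AE x in density lborel (exponential_density 1). 0 < x"
    by (subst AE_density, simp, rule AE_mp[OF AE_lborel_singleton[of 0]])
      (intro AE_I2, simp add: exponential_density_def)
  then have "AE x in distr (weight_law m n) (density lborel (exponential_density 1)) (\<lambda>w. w i). 0 < x"
    unfolding weight_law_def by (simp only: P.PiM_component[OF i])
  moreover have "(\<lambda>w. w i) \<in> weight_law m n \<rightarrow>\<^sub>M density lborel (exponential_density 1)"
    unfolding weight_law_def using i by (rule measurable_component_singleton)
  ultimately show "AE w in weight_law m n. 0 < w i"
    by (rule AE_distrD[rotated])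
qed simp

lemma prob_space_BR: "prob_space (BR m n)"
  unfolding BR_def
proof (rule prob_space.prob_space_bind[OF prob_space_weight_law _ measurable_BR_kernel])
  show "AE w in weight_law m n. prob_space (distr (left_law m n w) (BR_algebra m n) (\<lambda>l. (w, l)))"
    using AE_weight_law_pos AE_space
  proof eventually_elim
    case (elim w)
    have "0 < R m n w k" if "k \<in> {1..m * n}" for k
      unfolding R_def W_def using that elim(1) by (intro divide_pos_pos sum_pos) auto
    moreover have "(\<lambda>l. (w, l)) \<in> left_law m n w \<rightarrow>\<^sub>M BR_algebra m n"
      using elim(2) unfolding BR_algebra_def
      by (intro measurable_Pair measurable_const)
        (auto simp: weight_law_def space_PiM sets_left_law cong: measurable_cong_sets)
    ultimately show ?case
      by (intro prob_space.prob_space_distr prob_space_left_law)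
  qed
qed

lemma sets_BR: "sets (BR m n) = sets (BR_algebra m n)"
  unfolding BR_def
  by (rule sets_bind[OF sets_kernel[OF measurable_BR_kernel]])
    (simp_all add: prob_space.not_empty prob_space_weight_law)

end

theory Submission
  imports Defs "HOL-Real_Asymp.Multiseries_Expansion"
begin

text \<open>
  The vertex set \<open>V\<close> of a maximal recursive tree inside \<open>[\<mu>]\<close> contains only vertices that are not
  selected by any vertex \<open>b > \<mu>\<close>, so it suffices to bound the number of such unselected vertices.

  Given the weights, a left endpoint \<open>\<ell>\<^sub>k\<close> with \<open>k > m\<mu>\<close> falls into the interval of \<open>a \<le> \<mu>\<close> with
  probability at least \<open>\<Gamma>\<^sub>a / (2 sqrt (W\<^bsub>m\<mu>\<^esub> W\<^bsub>mn+1\<^esub>))\<close>, where \<open>\<Gamma>\<^sub>a\<close> is the sum of the \<open>m\<close> weights of \<open>a\<close>;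
  this only uses \<open>R\<^sub>k \<le> 1\<close>. Put \<open>s = (n/\<mu>)\<^bsup>1/4\<^esup>\<close>. By Markov, with probability at least \<open>1 - 2/s\<close> both
  \<open>W\<^bsub>m\<mu>\<^esub>\<close> and \<open>W\<^bsub>mn+1\<^esub>\<close> are at most \<open>s\<close> times their means, and then, if \<open>2\<mu> \<le> n\<close>, the conditional
  probability that \<open>a\<close> is unselected is at most \<open>exp (- s \<Gamma>\<^sub>a / 6)\<close>, whose mean
  \<open>(1 + s/6)\<^bsup>-m\<^esup>\<close> is at most \<open>(6/s)\<^sup>m\<close>. A second use of Markov bounds the probability of \<open>c\<close> or more
  unselected vertices by \<open>2/s + (\<mu>/c) (6/s)\<^sup>m\<close>. Part (1) is \<open>c = 1\<close>, part (2) is \<open>c = \<kappa>\<mu>\<close>.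
\<close>

section \<open>Deterministic reduction to unselected vertices\<close>

text \<open>Only endpoints of vertices beyond \<open>\<mu>\<close> are tested. Such vertices never
  lie in a set \<open>V\<close> inside \<open>{1..\<mu>}\<close>, and for positive weights their
  \<open>R m n w k\<close> lies to the right of every cell in question, so each whole cell is within
  reach of the endpoint density.\<close>

definition unselected :: "nat \<Rightarrow> nat \<Rightarrow> nat \<Rightarrow> (nat \<Rightarrow> real) \<Rightarrow> (nat \<Rightarrow> real) \<Rightarrow> nat set" where
  "unselected m n \<mu> w l = {a \<in> {1..\<mu>}. \<forall>k\<in>{m * \<mu> + 1..m * n}. l k \<notin> cell m n w a}"

definition max_tree_event ::
  "nat \<Rightarrow> nat \<Rightarrow> (nat set \<Rightarrow> bool) \<Rightarrow> ((nat \<Rightarrow> real) \<times> (nat \<Rightarrow> real)) set" where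
  "max_tree_event m n Q =
     {\<omega> \<in> space (BR m n). \<exists>V E. Q V \<and> maximal_recursive_tree m n \<omega> V E}"

text \<open>An endpoint \<open>l k\<close> in the cell of \<open>a\<close> makes the vertex owning
  edge \<open>k\<close> select \<open>a\<close>. For \<open>k > m * \<mu>\<close> that vertex
  exceeds \<open>\<mu>\<close>, hence lies outside \<open>V\<close>, against maximality.\<close>

lemma maximal_recursive_tree_imp_unselected:
  assumes "1 \<le> m" "\<mu> \<le> n" "V \<subseteq> {1..\<mu>}" "maximal_recursive_tree m n (w, l) V E"
  shows "V \<subseteq> unselected m n \<mu> w l"
proof
  fix a assume a: "a \<in> V"
  have "l k \<notin> cell m n w a" if k: "k \<in> {m * \<mu> + 1..m * n}" for k
  proof
    assume lk: "l k \<in> cell m n w a"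
    \<comment> \<open>Edge numbers start at 1, so edge \<open>k\<close> belongs to the vertex
      \<open>Suc q\<close>.\<close>
    define q where "q = (k - 1) div m"
    have k1: "k - 1 = m * q + (k - 1) mod m" and r: "(k - 1) mod m < m"
      using assms(1) by (simp_all add: q_def)
    have kk: "k = m * q + (k - 1) mod m + 1" using k1 k by simp
    have "m * \<mu> div m \<le> q" unfolding q_def using k by (intro div_le_mono) auto
    then have q1: "\<mu> \<le> q" using assms(1) by simp
    have "m * q + (k - 1) mod m < m * n" using kk k by simp
    then have "m * q < m * n" by linarith
    then have q2: "q < n" by simp
    have "k \<in> {m * (Suc q - 1) + 1..m * Suc q}" using kk r by simp
    moreover have "a \<in> {1..n}" "a < Suc q" using a assms q1 by auto
    ultimately have "selects m n (w, l) (Suc q) a"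
      unfolding selects_def using lk q2 by auto
    moreover have "Suc q \<in> {1..n} - V" using q1 q2 assms(3) by auto
    ultimately show False
      using assms(4) a unfolding maximal_recursive_tree_def by blast
  qed
  then show "a \<in> unselected m n \<mu> w l" using a assms(3) by (auto simp: unselected_def)
qed

section \<open>Measurability of the tree event\<close>

text \<open>The point is a general measurable \<open>f\<close> because \<open>joins\<close> tests
  both \<open>R m n w k\<close> and \<open>l k\<close> for membership in a cell.\<close>

lemma pred_cell:
  assumes "j \<in> {1..n}" and [measurable]: "f \<in> borel_measurable (BR_algebra m n)"
  shows "Measurable.pred (BR_algebra m n) (\<lambda>\<omega>. f \<omega> \<in> cell m n (fst \<omega>) j)"
proof -
  have R: "(\<lambda>\<omega>. R m n (fst \<omega>) i) \<in> borel_measurable (BR_algebra m n)" if "i \<le> m * n" for i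
    unfolding BR_algebra_def using that
    by (intro measurable_compose[OF measurable_fst measurable_R]) auto
  have [measurable]: "(\<lambda>\<omega>. R m n (fst \<omega>) (m * (j - 1))) \<in> borel_measurable (BR_algebra m n)"
    "(\<lambda>\<omega>. R m n (fst \<omega>) (m * j)) \<in> borel_measurable (BR_algebra m n)"
    using assms(1) by (auto intro!: R)
  show ?thesis unfolding cell_def greaterThanAtMost_iff by measurable
qed

lemma measurable_left_endpoint:
  "k \<in> {1..m * n} \<Longrightarrow> (\<lambda>\<omega>. snd \<omega> k) \<in> borel_measurable (BR_algebra m n)"
  unfolding BR_algebra_def
  by (rule measurable_compose[OF measurable_snd measurable_component_singleton])

lemma pred_joins:
  assumes "k \<in> {1..m * n}"
  shows "Measurable.pred (BR_algebra m n) (\<lambda>\<omega>. joins m n \<omega> k a b)"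
proof (cases "a \<in> {1..n} \<and> b \<in> {1..n}")
  case True
  have Rk: "(\<lambda>\<omega>. R m n (fst \<omega>) k) \<in> borel_measurable (BR_algebra m n)"
    unfolding BR_algebra_def using assms
    by (intro measurable_compose[OF measurable_fst measurable_R]) auto
  show ?thesis
    unfolding joins_def case_prod_unfold using True
    by (intro pred_intros_logic pred_cell measurable_left_endpoint Rk assms) auto
next
  case False
  then have "(\<lambda>\<omega>. joins m n \<omega> k a b) = (\<lambda>_. False)"
    by (auto simp: joins_def fun_eq_iff)
  then show ?thesis by simp
qed

lemma pred_selects: "Measurable.pred (BR_algebra m n) (\<lambda>\<omega>. selects m n \<omega> b a)"
proof (cases "a \<in> {1..n} \<and> b \<in> {1..n} \<and> a < b")
  case True
  have "m * b \<le> m * n" using True by simp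
  then have "k \<in> {1..m * n}" if "k \<in> {m * (b - 1) + 1..m * b}" for k
    using that by (simp only: atLeastAtMost_iff) linarith
  then show ?thesis
    unfolding selects_def case_prod_unfold using True
    by (intro pred_intros_logic pred_intros_finite pred_cell measurable_left_endpoint) auto
next
  case False
  then have "(\<lambda>\<omega>. selects m n \<omega> b a) = (\<lambda>_. False)"
    by (auto simp: selects_def fun_eq_iff)
  then show ?thesis by simp
qed

lemma pred_walk:
  assumes "E \<subseteq> {1..m * n}"
  shows "Measurable.pred (BR_algebra m n) (\<lambda>\<omega>. walk (joins m n \<omega>) E u p v)"
proof (induction p arbitrary: u)
  case (Cons kx p)
  obtain k x where kx: "kx = (k, x)" by fastforce
  show ?case
  proof (cases "k \<in> E")
    case True
    then show ?thesis unfolding kx walk.simps using assms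
      by (intro pred_intros_logic pred_joins Cons) auto
  qed (simp add: kx)
qed simp

text \<open>With \<open>V\<close> and \<open>E\<close> fixed, every quantifier ranges over a finite
  set or over vertices and walks, and these are countable since walks are lists of pairs of
  naturals.\<close>

lemma pred_maximal_recursive_tree:
  assumes "V \<subseteq> {1..n}" "E \<subseteq> {1..m * n}"
  shows "Measurable.pred (BR_algebra m n) (\<lambda>\<omega>. maximal_recursive_tree m n \<omega> V E)"
proof -
  have fin: "finite V" "finite E" using assms by (auto intro: finite_subset)
  show ?thesis
    unfolding maximal_recursive_tree_def recursive_tree_def is_subgraph_def is_tree_def
      is_cycle_def is_path_def
    using fin assms(2)
    by (intro pred_intros_logic pred_intros_finite pred_intros_countable
        pred_joins pred_selects pred_walk) auto
qed

text \<open>A subgraph has its vertices in \<open>{1..n}\<close> and its edges in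
  \<open>{1..m * n}\<close>, so the existential quantifiers amount to a finite union, whatever
  \<open>Q\<close> is.\<close>

lemma max_tree_event_measurable: "max_tree_event m n Q \<in> sets (BR m n)"
proof -
  have sp: "space (BR m n) = space (BR_algebra m n)" by (rule sets_eq_imp_space_eq[OF sets_BR])
  have VE: "V \<subseteq> {1..n} \<and> E \<subseteq> {1..m * n}" if "maximal_recursive_tree m n \<omega> V E" for \<omega> V E
    using that
    by (simp add: maximal_recursive_tree_def recursive_tree_def is_subgraph_def)
  have "max_tree_event m n Q = (\<Union>V\<in>{V\<in>Pow {1..n}. Q V}. \<Union>E\<in>Pow {1..m * n}.
      {\<omega> \<in> space (BR_algebra m n). maximal_recursive_tree m n \<omega> V E})"
  proof (intro set_eqI iffI)
    fix \<omega> assume "\<omega> \<in> max_tree_event m n Q"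
    then obtain V E where "\<omega> \<in> space (BR_algebra m n)" "Q V" "maximal_recursive_tree m n \<omega> V E"
      by (auto simp: max_tree_event_def sp)
    then show "\<omega> \<in> (\<Union>V\<in>{V\<in>Pow {1..n}. Q V}. \<Union>E\<in>Pow {1..m * n}.
        {\<omega> \<in> space (BR_algebra m n). maximal_recursive_tree m n \<omega> V E})"
      using VE[of \<omega> V E] by blast
  qed (auto simp: max_tree_event_def sp)
  also have "\<dots> \<in> sets (BR_algebra m n)"
    using pred_maximal_recursive_tree by (intro sets.finite_UN) (auto simp: pred_def)
  finally show ?thesis by (simp add: sets_BR)
qed

section \<open>Conditioning on the weights, and exponential integrals\<close>

text \<open>Disintegration along the weights: the later estimates fix \<open>w\<close>, work under
  the product measure \<open>left_law m n w\<close>, and integrate over \<open>w\<close>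
  last.\<close>

lemma emeasure_BR:
  assumes X: "X \<in> sets (BR m n)"
  shows "emeasure (BR m n) X =
    (\<integral>\<^sup>+w. emeasure (left_law m n w) {l \<in> space (left_law m n w). (w, l) \<in> X} \<partial>weight_law m n)"
proof -
  have X': "X \<in> sets (BR_algebra m n)" using X by (simp add: sets_BR)
  have "emeasure (BR m n) X =
      (\<integral>\<^sup>+w. emeasure (distr (left_law m n w) (BR_algebra m n) (\<lambda>l. (w, l))) X \<partial>weight_law m n)"
    unfolding BR_def
    by (rule emeasure_bind[OF prob_space.not_empty[OF prob_space_weight_law]
          measurable_BR_kernel X'])
  also have "\<dots> = (\<integral>\<^sup>+w. emeasure (left_law m n w) {l \<in> space (left_law m n w). (w, l) \<in> X}
      \<partial>weight_law m n)"
  proof (intro nn_integral_cong)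
    fix w assume "w \<in> space (weight_law m n)"
    then have "(\<lambda>l. (w, l)) \<in> left_law m n w \<rightarrow>\<^sub>M BR_algebra m n"
      unfolding BR_algebra_def
      by (intro measurable_Pair measurable_const)
        (auto simp: weight_law_def space_PiM sets_left_law cong: measurable_cong_sets)
    then show "emeasure (distr (left_law m n w) (BR_algebra m n) (\<lambda>l. (w, l))) X =
        emeasure (left_law m n w) {l \<in> space (left_law m n w). (w, l) \<in> X}"
      using X' by (subst emeasure_distr) (auto intro!: arg_cong2[where f = emeasure])
  qed
  finally show ?thesis .
qed

text \<open>Exponential tilting: the factor \<open>exp (- c * x)\<close> turns the density of rate 1
  into \<open>1 / (1 + c)\<close> times the density of rate \<open>1 + c\<close>, which has mass
  1.\<close>

lemma nn_integral_exponential_exp: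
  assumes "0 \<le> c"
  shows "(\<integral>\<^sup>+x. ennreal (exp (- c * x)) \<partial>density lborel (exponential_density 1)) = ennreal (1 / (1 + c))"
proof -
  have p: "prob_space (density lborel (exponential_density (1 + c)))"
    using assms by (intro prob_space_exponential_density) simp
  have "(\<integral>\<^sup>+x. ennreal (exp (- c * x)) \<partial>density lborel (exponential_density 1))
      = (\<integral>\<^sup>+x. ennreal (1 / (1 + c)) * ennreal (exponential_density (1 + c) x) \<partial>lborel)"
  proof (subst nn_integral_density)
    have "exponential_density 1 x * exp (- c * x) = 1 / (1 + c) * exponential_density (1 + c) x"
      for x
      using assms
      by (simp add: exponential_density_def mult_exp_exp) (simp add: algebra_simps)
    then show "(\<integral>\<^sup>+x. ennreal (exponential_density 1 x) * ennreal (exp (- c * x)) \<partial>lborel)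
        = (\<integral>\<^sup>+x. ennreal (1 / (1 + c)) * ennreal (exponential_density (1 + c) x) \<partial>lborel)"
      using assms by (simp add: ennreal_mult'[symmetric])
  qed auto
  also have "\<dots> = ennreal (1 / (1 + c)) * (\<integral>\<^sup>+x. ennreal (exponential_density (1 + c) x) \<partial>lborel)"
    by (rule nn_integral_cmult) simp
  also have "(\<integral>\<^sup>+x. ennreal (exponential_density (1 + c) x) \<partial>lborel) = 1"
    using prob_space.emeasure_space_1[OF p] by (simp add: emeasure_density)
  finally show ?thesis by simp
qed

lemma nn_integral_exponential_id:
  "(\<integral>\<^sup>+x. ennreal x \<partial>density lborel (exponential_density 1)) = 1"
  using nn_integral_erlang_ith_moment[of 1 0 1]
  by (simp add: nn_integral_density ennreal_mult')

lemma nn_integral_weight_law_component: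
  assumes "i \<in> {1..m * n + 1}" and [measurable]: "f \<in> borel_measurable borel"
  shows "(\<integral>\<^sup>+w. f (w i) \<partial>weight_law m n) =
    (\<integral>\<^sup>+x. f x \<partial>density lborel (exponential_density 1))"
proof -
  interpret P: product_prob_space "\<lambda>_::nat. density lborel (exponential_density 1)"
    "{1..m * n + 1}"
    by (intro product_prob_spaceI prob_space_exponential_density) simp
  show ?thesis
    unfolding weight_law_def using assms(1)
    by (subst P.PiM_component[OF assms(1), symmetric], subst nn_integral_distr) auto
qed

lemma nn_integral_weight_law_exp_sum:
  assumes I: "I \<subseteq> {1..m * n + 1}" and c: "0 \<le> c"
  shows "(\<integral>\<^sup>+w. ennreal (exp (- c * (\<Sum>i\<in>I. w i))) \<partial>weight_law m n)
    = ennreal ((1 / (1 + c)) ^ card I)"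
proof -
  interpret P: product_prob_space "\<lambda>_::nat. density lborel (exponential_density 1)"
    "{1..m * n + 1}"
    by (intro product_prob_spaceI prob_space_exponential_density) simp
  \<comment> \<open>Padding by the constant 1 outside \<open>I\<close> makes the product formula
    over the full index set applicable.\<close>
  let ?f = "\<lambda>i x. if i \<in> I then ennreal (exp (- c * x)) else 1"
  have fin: "finite I" using I by (rule finite_subset) simp
  have "ennreal (exp (- c * (\<Sum>i\<in>I. w i))) = (\<Prod>i\<in>{1..m * n + 1}. ?f i (w i))" for w :: "nat \<Rightarrow> real"
  proof -
    have "ennreal (exp (- c * (\<Sum>i\<in>I. w i))) = (\<Prod>i\<in>I. ennreal (exp (- c * w i)))"
      using fin by (simp add: sum_distrib_left exp_sum prod_ennreal sum_negf[symmetric])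
    also have "\<dots> = (\<Prod>i\<in>{1..m * n + 1}. ?f i (w i))"
      using I by (intro prod.mono_neutral_cong_left) auto
    finally show ?thesis .
  qed
  then have "(\<integral>\<^sup>+w. ennreal (exp (- c * (\<Sum>i\<in>I. w i))) \<partial>weight_law m n)
      = (\<integral>\<^sup>+w. (\<Prod>i\<in>{1..m * n + 1}. ?f i (w i)) \<partial>weight_law m n)"
    by simp
  also have "\<dots> = (\<Prod>i\<in>{1..m * n + 1}. \<integral>\<^sup>+x. ?f i x \<partial>density lborel (exponential_density 1))"
    unfolding weight_law_def by (intro P.product_nn_integral_prod) auto
  also have "\<dots> = (\<Prod>i\<in>I. ennreal (1 / (1 + c)))"
    using I nn_integral_exponential_exp[OF c]
      prob_space.emeasure_space_1[OF prob_space_exponential_density[of 1]]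
    by (intro prod.mono_neutral_cong_right) auto
  also have "\<dots> = ennreal ((1 / (1 + c)) ^ card I)"
    using c by (simp add: ennreal_power)
  finally show ?thesis .
qed

lemma nn_integral_weight_law_W:
  assumes "k \<le> m * n + 1"
  shows "(\<integral>\<^sup>+w. ennreal (W w k) \<partial>weight_law m n) = ennreal (real k)"
proof -
  \<comment> \<open>Almost sure positivity matters here: \<open>ennreal\<close> truncates negative
    reals to 0 and commutes with the sum only for nonnegative weights.\<close>
  have "(\<integral>\<^sup>+w. ennreal (W w k) \<partial>weight_law m n)
      = (\<integral>\<^sup>+w. (\<Sum>i=1..k. ennreal (w i)) \<partial>weight_law m n)"
    using AE_weight_law_pos[of m n] assms
    by (intro nn_integral_cong_AE)
      (auto simp: W_def intro!: sum_ennreal[symmetric] less_imp_le elim!: eventually_mono)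
  also have "\<dots> = (\<Sum>i=1..k. \<integral>\<^sup>+w. ennreal (w i) \<partial>weight_law m n)"
    using assms
    by (intro nn_integral_sum measurable_compose[OF _ measurable_ennreal])
      (auto simp: weight_law_def)
  also have "\<dots> = (\<Sum>i=1..k. 1)"
    using assms
    by (intro sum.cong refl)
      (subst nn_integral_weight_law_component, auto simp: nn_integral_exponential_id)
  finally show ?thesis by (simp add: ennreal_of_nat_eq_real_of_nat)
qed

section \<open>Avoiding a cell, given the weights\<close>

text \<open>The event is a box with \<open>UNIV\<close> at the coordinates outside \<open>K\<close>;
  those factors equal 1 because positivity of \<open>R m n w k\<close> gives each density total mass
  1.\<close>

lemma emeasure_left_law_avoid:
  assumes w: "\<And>k. k \<in> {1..m * n} \<Longrightarrow> 0 < R m n w k" and K: "K \<subseteq> {1..m * n}"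
    and S: "S \<in> sets borel"
  shows "emeasure (left_law m n w) {l \<in> space (left_law m n w). \<forall>k\<in>K. l k \<notin> S}
    = (\<Prod>k\<in>K. emeasure (density lborel (left_density (R m n w k))) (- S))"
proof -
  interpret P: product_sigma_finite "\<lambda>k. density lborel (left_density (R m n w k))"
    by (intro product_sigma_finite.intro finite_measure.sigma_finite_measure
      subprob_space.axioms(1) subprob_space_left_density)
  have "{l \<in> space (left_law m n w). \<forall>k\<in>K. l k \<notin> S} =
      PiE {1..m * n} (\<lambda>k. if k \<in> K then - S else UNIV)"
    using K by (auto simp: left_law_def space_PiM PiE_iff extensional_def split: if_splits)
  then have "emeasure (left_law m n w) {l \<in> space (left_law m n w). \<forall>k\<in>K. l k \<notin> S}
      = (\<Prod>k\<in>{1..m * n}. emeasure (density lborel (left_density (R m n w k)))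
          (if k \<in> K then - S else UNIV))"
    using S by (simp add: left_law_def) (subst P.emeasure_PiM, auto)
  also have "\<dots> = (\<Prod>k\<in>K. emeasure (density lborel (left_density (R m n w k))) (- S))"
    using K w
    by (intro prod.mono_neutral_cong_right) (auto simp: emeasure_density nn_integral_left_density)
  finally show ?thesis .
qed

text \<open>On the interval from \<open>x\<close> to \<open>y\<close> the density is at least
  \<open>1 / (2 * sqrt y)\<close>, since \<open>r \<le> 1\<close> and \<open>z \<le> y\<close>. The
  interval thus has mass at least \<open>t = (y - x) / (2 * sqrt y)\<close>, and
  \<open>1 - t \<le> exp (- t)\<close>.\<close>

lemma emeasure_left_density_avoid_le:
  assumes "0 \<le> x" "x \<le> y" "0 < y" "y \<le> r" "r \<le> 1"
  shows "emeasure (density lborel (left_density r)) (- {x<..y})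
    \<le> ennreal (exp (- ((y - x) / (2 * sqrt y))))"
proof -
  let ?M = "density lborel (left_density r)"
  interpret prob_space ?M
    using assms by (intro prob_spaceI) (simp add: emeasure_density nn_integral_left_density)
  have "ennreal ((y - x) / (2 * sqrt y)) = (\<integral>\<^sup>+z. ennreal (1 / (2 * sqrt y)) * indicator {x<..y} z \<partial>lborel)"
    using assms by (simp add: nn_integral_cmult_indicator ennreal_mult[symmetric])
  also have "\<dots> \<le> (\<integral>\<^sup>+z. ennreal (left_density r z) * indicator {x<..y} z \<partial>lborel)"
  proof (intro nn_integral_mono)
    fix z
    have "1 / (2 * sqrt y) \<le> left_density r z" if "z \<in> {x<..y}"
    proof -
      have "r * z \<le> 1 * y" using assms that by (intro mult_mono) auto
      moreover have "0 < r * z" using assms that by (intro mult_pos_pos) auto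
      ultimately show ?thesis using assms that
        by (auto simp: left_density_def intro!: divide_left_mono)
    qed
    then show "ennreal (1 / (2 * sqrt y)) * indicator {x<..y} z
        \<le> ennreal (left_density r z) * indicator {x<..y} z"
      by (auto split: split_indicator intro: ennreal_leI)
  qed
  also have "\<dots> = emeasure ?M {x<..y}"
    by (simp add: emeasure_density)
  finally have "(y - x) / (2 * sqrt y) \<le> prob {x<..y}"
    using assms by (simp add: emeasure_eq_measure)
  moreover have "prob (- {x<..y}) = 1 - prob {x<..y}"
    using prob_compl[of "{x<..y}"] by (simp add: Compl_eq_Diff_UNIV)
  moreover have "1 - (y - x) / (2 * sqrt y) \<le> exp (- ((y - x) / (2 * sqrt y)))"
    using exp_ge_add_one_self[of "- ((y - x) / (2 * sqrt y))"] by simp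
  ultimately show ?thesis by (simp add: emeasure_eq_measure ennreal_leI)
qed

lemma W_diff:
  assumes "i \<le> j"
  shows "W w j - W w i = (\<Sum>k=i + 1..j. w k)"
  unfolding W_def using sum.ub_add_nat[of 1 i w "j - i"] assms by simp

lemma W_mono:
  assumes "\<forall>k\<in>{1..N}. 0 < w k" "i \<le> j" "j \<le> N"
  shows "W w i \<le> W w j"
proof -
  have "0 \<le> (\<Sum>k=i + 1..j. w k)" using assms by (intro sum_nonneg) (auto intro: less_imp_le)
  then show ?thesis using W_diff[OF assms(2), of w] by simp
qed

lemma W_pos:
  assumes "\<forall>k\<in>{1..N}. 0 < w k" "1 \<le> i" "i \<le> N"
  shows "0 < W w i"
  unfolding W_def using assms by (intro sum_pos) auto

text \<open>Each tested edge contributes the exponent \<open>\<Gamma> / (2 * sqrt (A * T))\<close>,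
  and there are at least \<open>m * n / 2\<close> of them. Allowing both partial sums to exceed
  their means by the factor \<open>s\<close> leaves a total exponent of order
  \<open>\<Gamma> * sqrt (n / \<mu>) / s\<close>; the relation \<open>s ^ 4 * \<mu> = n\<close>
  balances this against \<open>s\<close> and turns it into order
  \<open>s * \<Gamma>\<close>.\<close>

lemma emeasure_left_law_vertex_unselected_le:
  assumes m: "1 \<le> m" and a: "1 \<le> a" "a \<le> \<mu>" and n: "2 * \<mu> \<le> n"
    and pos: "\<forall>i\<in>{1..m * n + 1}. 0 < w i"
    and s: "0 < s" "s ^ 4 * real \<mu> = real n"
    and W1: "W w (m * \<mu>) \<le> s * real (m * \<mu>)"
    and W2: "W w (m * n + 1) \<le> s * real (m * n + 1)"
  shows "emeasure (left_law m n w)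
      {l \<in> space (left_law m n w). \<forall>k\<in>{m * \<mu> + 1..m * n}. l k \<notin> cell m n w a}
    \<le> ennreal (exp (- (s / 6) * (\<Sum>i=m * (a - 1) + 1..m * a. w i)))"
proof -
  define A where "A = W w (m * a)"
  define T where "T = W w (m * n + 1)"
  define \<Gamma> where "\<Gamma> = (\<Sum>i=m * (a - 1) + 1..m * a. w i)"
  define x where "x = R m n w (m * (a - 1))"
  define y where "y = R m n w (m * a)"
  have an: "m * (a - 1) \<le> m * a" "m * a \<le> m * \<mu>" "m * \<mu> \<le> m * n" "1 \<le> m * a" "1 \<le> m * n"
    using m a n by auto
  have aN: "m * a \<le> m * n + 1" "m * \<mu> \<le> m * n + 1" using an(2,3) by linarith+
  have T: "0 < T" unfolding T_def by (rule W_pos[OF pos]) auto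
  have A: "0 < A" unfolding A_def by (rule W_pos[OF pos an(4) aN(1)])
  have W0: "0 \<le> W w (m * (a - 1))"
    using W_mono[OF pos le0 order_trans[OF an(1) aN(1)]] by (simp add: W_def)
  have \<Gamma>: "\<Gamma> = A - W w (m * (a - 1))" unfolding \<Gamma>_def A_def using W_diff[OF an(1), of w] by simp
  have \<Gamma>0: "0 \<le> \<Gamma>" unfolding \<Gamma> A_def using W_mono[OF pos an(1) aN(1)] by simp
  have yA: "y = A / T" and xA: "x = (A - \<Gamma>) / T"
    by (simp_all add: y_def x_def R_def A_def T_def \<Gamma>)
  have x: "0 \<le> x" using W0 T by (simp add: xA \<Gamma>)
  have xy: "x \<le> y" using \<Gamma>0 T by (simp add: xA yA divide_right_mono)
  have y: "0 < y" using A T by (simp add: yA)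
  have Rpos: "0 < R m n w k" if "k \<in> {1..m * n}" for k
    unfolding R_def using that T W_pos[OF pos, of k] by (simp add: T_def)
  have "emeasure (left_law m n w)
      {l \<in> space (left_law m n w). \<forall>k\<in>{m * \<mu> + 1..m * n}. l k \<notin> cell m n w a}
      = (\<Prod>k=m * \<mu> + 1..m * n. emeasure (density lborel (left_density (R m n w k))) (- {x<..y}))"
    unfolding x_def y_def cell_def[symmetric]
    by (rule emeasure_left_law_avoid[OF Rpos]) (auto simp: cell_def)
  also have "\<dots> \<le> (\<Prod>k=m * \<mu> + 1..m * n. ennreal (exp (- ((y - x) / (2 * sqrt y)))))"
  proof (intro prod_mono_ennreal emeasure_left_density_avoid_le x xy y)
    fix k assume k: "k \<in> {m * \<mu> + 1..m * n}"
    show "y \<le> R m n w k"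
      unfolding y_def R_def T_def[symmetric] using k an(2) T
      by (intro divide_right_mono W_mono[OF pos]) (simp_all only: atLeastAtMost_iff, linarith+)
    show "R m n w k \<le> 1"
      unfolding R_def using W_mono[OF pos, of k "m * n + 1"] k T by (simp add: T_def)
  qed
  also have "\<dots> = ennreal (exp (- (real (m * n - m * \<mu>) * ((y - x) / (2 * sqrt y)))))"
    by (simp add: ennreal_power exp_of_nat_mult[symmetric])
  also have "\<dots> \<le> ennreal (exp (- (s / 6) * \<Gamma>))"
  proof (intro ennreal_leI)
    have eq: "(y - x) / (2 * sqrt y) = \<Gamma> / (2 * sqrt (A * T))"
    proof -
      have "(y - x) / (2 * sqrt y) = \<Gamma> / T / (2 * (sqrt A / sqrt T))"
        by (simp add: xA yA real_sqrt_divide diff_divide_distrib)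
      also have "\<dots> = \<Gamma> / (2 * sqrt A * (T / sqrt T))" by simp
      also have "T / sqrt T = sqrt T" using T by (simp add: real_div_sqrt)
      finally show ?thesis by (simp add: real_sqrt_mult)
    qed
    \<comment> \<open>The constant \<open>3 / 2\<close> is a rational upper bound for the square
      root of 2.\<close>
    have le: "sqrt (A * T) \<le> 3 / 2 * (real (m * n) / s)"
    proof (rule real_le_lsqrt)
      have "A \<le> s * real (m * \<mu>)" unfolding A_def using W1 W_mono[OF pos an(2) aN(2)] by simp
      \<comment> \<open>The doubling absorbs the extra weight with index
        \<open>m * n + 1\<close>.\<close>
      moreover have "T \<le> s * (2 * real (m * n))"
      proof -
        have "real (m * n + 1) \<le> 2 * real (m * n)" using an(5) by linarith
        then have "s * real (m * n + 1) \<le> s * (2 * real (m * n))"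
          using s(1) by (intro mult_left_mono) auto
        then show ?thesis using W2 unfolding T_def by linarith
      qed
      ultimately have "A * T \<le> (s * real (m * \<mu>)) * (s * (2 * real (m * n)))"
        using A T s by (intro mult_mono) auto
      also have "\<dots> = 2 * (real m)\<^sup>2 * real n * (s ^ 4 * real \<mu>) / s\<^sup>2"
        using s(1) by (simp add: field_simps power2_eq_square power4_eq_xxxx)
      also have "\<dots> = 2 * (real (m * n) / s)\<^sup>2"
        unfolding s(2) by (simp add: power2_eq_square)
      also have "\<dots> \<le> (3 / 2 * (real (m * n) / s))\<^sup>2"
        unfolding power_mult_distrib[of "3 / 2"]
        by (intro mult_right_mono zero_le_power2) (simp add: power2_eq_square)
      finally show "A * T \<le> (3 / 2 * (real (m * n) / s))\<^sup>2" .
    qed (use s in auto)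
    \<comment> \<open>By \<open>2 * \<mu> \<le> n\<close>, at least half of all edges start beyond
      \<open>\<mu>\<close>.\<close>
    have half: "real (m * n) / 2 \<le> real (m * n - m * \<mu>)"
    proof -
      have "2 * (m * \<mu>) \<le> m * n" using n mult_le_mono2[OF n, of m] by (simp add: ac_simps)
      then show ?thesis by linarith
    qed
    have "(real (m * n) / 2) * (\<Gamma> / (2 * (3 / 2 * (real (m * n) / s))))
        \<le> real (m * n - m * \<mu>) * ((y - x) / (2 * sqrt y))"
      unfolding eq
    proof (intro mult_mono half divide_left_mono mult_left_mono le \<Gamma>0 mult_pos_pos)
      show "0 < sqrt (A * T)" using A T by simp
      show "0 < real (m * n) / s" using s(1) an(5) by (intro divide_pos_pos) auto
      show "0 \<le> \<Gamma> / (2 * (3 / 2 * (real (m * n) / s)))" using \<Gamma>0 s(1) by simp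
    qed (use A T in auto)
    \<comment> \<open>The 6 is the product of 2 (half of the edges), 2 (from the density) and
      \<open>3 / 2\<close>.\<close>
    moreover have "(real (m * n) / 2) * (\<Gamma> / (2 * (3 / 2 * (real (m * n) / s)))) = s / 6 * \<Gamma>"
      using an(5) s(1) by (simp add: field_simps)
    ultimately show "exp (- (real (m * n - m * \<mu>) * ((y - x) / (2 * sqrt y))))
        \<le> exp (- (s / 6) * \<Gamma>)"
      unfolding exp_le_cancel_iff by linarith
  qed
  finally show ?thesis unfolding \<Gamma>_def .
qed

section \<open>The number of unselected vertices, given the weights\<close>

definition vertex_unselected_event ::
  "nat \<Rightarrow> nat \<Rightarrow> nat \<Rightarrow> (nat \<Rightarrow> real) \<Rightarrow> nat \<Rightarrow> (nat \<Rightarrow> real) set" where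
  "vertex_unselected_event m n \<mu> w a =
     {l \<in> space (left_law m n w). \<forall>k\<in>{m * \<mu> + 1..m * n}. l k \<notin> cell m n w a}"

lemma vertex_unselected_event_measurable:
  "vertex_unselected_event m n \<mu> w a \<in> sets (left_law m n w)"
proof -
  have "{l \<in> space (left_law m n w). l k \<notin> cell m n w a} \<in> sets (left_law m n w)"
    if "k \<in> {m * \<mu> + 1..m * n}" for k
  proof -
    have [measurable]: "(\<lambda>l. l k) \<in> borel_measurable (left_law m n w)"
      using that by (simp add: sets_left_law cong: measurable_cong_sets)
    have [measurable]: "cell m n w a \<in> sets borel" by (simp add: cell_def)
    show ?thesis by measurable
  qed
  then show ?thesis
    unfolding vertex_unselected_event_def by (intro sets.sets_Collect_finite_All) auto
qed

text \<open>Writing the count as a sum of indicators reduces both its measurability and its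
  conditional mean to single vertices.\<close>

lemma card_unselected:
  assumes "l \<in> space (left_law m n w)"
  shows "real (card (unselected m n \<mu> w l)) =
    (\<Sum>a=1..\<mu>. indicator (vertex_unselected_event m n \<mu> w a) l)"
proof -
  have "unselected m n \<mu> w l = {a \<in> {1..\<mu>}. l \<in> vertex_unselected_event m n \<mu> w a}"
    using assms by (auto simp: unselected_def vertex_unselected_event_def)
  then show ?thesis by (simp add: indicator_def sum.If_cases Int_def)
qed

lemma unselected_measurable:
  "{l \<in> space (left_law m n w). c \<le> real (card (unselected m n \<mu> w l))} \<in> sets (left_law m n w)"
proof -
  note [measurable] = vertex_unselected_event_measurable
  have "{l \<in> space (left_law m n w). c \<le> real (card (unselected m n \<mu> w l))} =
      {l \<in> space (left_law m n w). c \<le> (\<Sum>a=1..\<mu>. indicator (vertex_unselected_event m n \<mu> w a) l)}"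
    by (intro Collect_cong conj_cong refl) (simp add: card_unselected)
  also have "\<dots> \<in> sets (left_law m n w)" by measurable
  finally show ?thesis .
qed

text \<open>The bound has no case distinction on \<open>w\<close>, so only means are needed when
  \<open>w\<close> is averaged. The first two summands are the Markov bound in pointwise form: they
  reach 1 as soon as one of the partial sums is too large. Otherwise the third summand
  suffices.\<close>

lemma emeasure_left_law_unselected_le:
  assumes m: "1 \<le> m" and \<mu>: "1 \<le> \<mu>" "2 * \<mu> \<le> n"
    and pos: "\<forall>i\<in>{1..m * n + 1}. 0 < w i"
    and s: "0 < s" "s ^ 4 * real \<mu> = real n" and c: "0 < c"
  shows "emeasure (left_law m n w)
      {l \<in> space (left_law m n w). c \<le> real (card (unselected m n \<mu> w l))}
    \<le> ennreal (W w (m * \<mu>)) / ennreal (s * real (m * \<mu>))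
      + ennreal (W w (m * n + 1)) / ennreal (s * real (m * n + 1))
      + ennreal (1 / c) * (\<Sum>a=1..\<mu>. ennreal (exp (- (s / 6) * (\<Sum>i=m * (a - 1) + 1..m * a. w i))))"
    (is "emeasure ?M ?X \<le> ?b1 + ?b2 + ?b3")
proof -
  have \<mu>n: "m * \<mu> \<le> m * n" "1 \<le> m * \<mu>" using \<mu> m by auto
  have W: "0 < W w (m * n + 1)" "0 < W w (m * \<mu>)"
    using W_pos[OF pos, of "m * \<mu>"] W_pos[OF pos, of "m * n + 1"] \<mu>n by linarith+
  have Rpos: "0 < R m n w k" if "k \<in> {1..m * n}" for k
    unfolding R_def using that W(1) W_pos[OF pos, of k] by simp
  interpret prob_space ?M by (rule prob_space_left_law[OF Rpos])
  show ?thesis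
  proof (cases "W w (m * \<mu>) \<le> s * real (m * \<mu>) \<and> W w (m * n + 1) \<le> s * real (m * n + 1)")
    case False
    then consider "s * real (m * \<mu>) < W w (m * \<mu>)" | "s * real (m * n + 1) < W w (m * n + 1)"
      by linarith
    then have "1 \<le> ?b1 + ?b2"
    proof cases
      case 1
      then have "1 \<le> W w (m * \<mu>) / (s * real (m * \<mu>))" using s \<mu>n(2) m \<mu> by (simp add: divide_simps)
      then have "ennreal 1 \<le> ?b1" using s \<mu>n(2) m \<mu> W(2)
        by (subst divide_ennreal) (auto intro!: ennreal_leI)
      then show ?thesis by (simp add: add_increasing2)
    next
      case 2
      then have "1 \<le> W w (m * n + 1) / (s * real (m * n + 1))"
        using s by (subst le_divide_eq_1_pos)
          (simp_all add: add_pos_nonneg del: of_nat_add of_nat_mult of_nat_Suc)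
      then have "ennreal 1 \<le> ?b2" using s W(1)
        by (subst divide_ennreal)
          (auto intro!: ennreal_leI simp del: of_nat_add of_nat_mult of_nat_Suc)
      then show ?thesis by (simp add: add_increasing)
    qed
    then show ?thesis using emeasure_le_1[of ?X] by (simp add: add_increasing2)
  next
    case True
    let ?Y = "vertex_unselected_event m n \<mu> w"
    have int: "integrable ?M (indicat_real (?Y a))" for a
      by (simp add: vertex_unselected_event_measurable emeasure_eq_measure)
    have "?X = {l \<in> space ?M. c \<le> (\<Sum>a=1..\<mu>. indicator (?Y a) l)}"
      by (intro Collect_cong conj_cong refl) (simp add: card_unselected)
    \<comment> \<open>Markov's inequality for the number of unselected vertices at the threshold
      \<open>c\<close>.\<close>
    also have "emeasure ?M \<dots> \<le> ennreal ((1 / c) * (\<integral>l. (\<Sum>a=1..\<mu>. indicator (?Y a) l) \<partial>?M))"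
      using c
      by (intro integral_Markov_inequality Bochner_Integration.integrable_sum int)
        (auto intro!: sum_nonneg)
    also have "(\<integral>l. (\<Sum>a=1..\<mu>. indicator (?Y a) l) \<partial>?M) = (\<Sum>a=1..\<mu>. prob (?Y a))"
      using vertex_unselected_event_measurable
      by (subst Bochner_Integration.integral_sum[OF int]) (auto simp: Int_absorb2 sets.sets_into_space)
    also have "ennreal ((1 / c) * (\<Sum>a=1..\<mu>. prob (?Y a)))
        = ennreal (1 / c) * (\<Sum>a=1..\<mu>. emeasure ?M (?Y a))"
      using c by (subst ennreal_mult) (auto simp: emeasure_eq_measure sum_nonneg)
    also have "\<dots> \<le> ?b3"
      unfolding vertex_unselected_event_def using True
      by (intro mult_left_mono sum_mono emeasure_left_law_vertex_unselected_le assms) auto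
    finally show ?thesis by (simp add: add_increasing)
  qed
qed

section \<open>Averaging over the weights\<close>

text \<open>Each normalised partial sum has mean \<open>1 / s\<close>, and the Laplace transform of
  a block of \<open>m\<close> weights at \<open>s / 6\<close> bounds the remaining term.\<close>

lemma prob_max_tree_event_le:
  assumes m: "1 \<le> m" and \<mu>: "1 \<le> \<mu>" "2 * \<mu> \<le> n"
    and s: "0 < s" "s ^ 4 * real \<mu> = real n" and c: "0 < c"
  shows "measure (BR m n) (max_tree_event m n (\<lambda>V. V \<subseteq> {1..\<mu>} \<and> c \<le> real (card V)))
    \<le> 2 / s + real \<mu> / c * (6 / s) ^ m"
proof -
  let ?Q = "\<lambda>V. V \<subseteq> {1..\<mu>} \<and> c \<le> real (card V)"
  let ?\<Gamma> = "\<lambda>a w. (\<Sum>i=m * (a - 1) + 1..m * a. w i)"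
  interpret prob_space "BR m n" by (rule prob_space_BR)
  have \<mu>n: "m * \<mu> \<le> m * n" "1 \<le> m * \<mu>" using \<mu> m by auto
  have comp: "(\<lambda>w. w i) \<in> borel_measurable (weight_law m n)" if "i \<in> {1..m * n + 1}" for i
    using that by (simp add: weight_law_def)
  have mW: "(\<lambda>w. W w k) \<in> borel_measurable (weight_law m n)" if "k \<le> m * n + 1" for k
    unfolding W_def using that by (intro borel_measurable_sum comp) auto
  have block: "{m * (a - 1) + 1..m * a} \<subseteq> {1..m * n + 1}" if "a \<in> {1..\<mu>}" for a
  proof -
    have "m * a \<le> m * \<mu>" using that by simp
    then have "m * a \<le> m * n + 1" using \<mu>n(1) by linarith
    then show ?thesis by (intro atLeastatMost_subset_iff[THEN iffD2] disjI2 conjI) simp_all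
  qed
  have m\<Gamma>: "(\<lambda>w. ?\<Gamma> a w) \<in> borel_measurable (weight_law m n)" if "a \<in> {1..\<mu>}" for a
    using block[OF that] by (intro borel_measurable_sum comp) auto
  have "emeasure (BR m n) (max_tree_event m n ?Q) = (\<integral>\<^sup>+w. emeasure (left_law m n w)
      {l \<in> space (left_law m n w). (w, l) \<in> max_tree_event m n ?Q} \<partial>weight_law m n)"
    by (rule emeasure_BR[OF max_tree_event_measurable])
  also have "\<dots> \<le> (\<integral>\<^sup>+w. (ennreal (W w (m * \<mu>)) / ennreal (s * real (m * \<mu>))
      + ennreal (W w (m * n + 1)) / ennreal (s * real (m * n + 1))
      + ennreal (1 / c) * (\<Sum>a=1..\<mu>. ennreal (exp (- (s / 6) * ?\<Gamma> a w)))) \<partial>weight_law m n)"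
  proof (rule nn_integral_mono_AE, rule AE_mp[OF AE_weight_law_pos], rule AE_I2, rule impI)
    fix w :: "nat \<Rightarrow> real" assume pos: "\<forall>i\<in>{1..m * n + 1}. 0 < w i"
    \<comment> \<open>A tree with at least \<open>c\<close> vertices forces at least
      \<open>c\<close> unselected ones.\<close>
    have "c \<le> real (card (unselected m n \<mu> w l))" if wl: "(w, l) \<in> max_tree_event m n ?Q" for l
    proof -
      obtain V E where V: "V \<subseteq> {1..\<mu>}" "c \<le> real (card V)" "maximal_recursive_tree m n (w, l) V E"
        using wl by (auto simp: max_tree_event_def)
      have "V \<subseteq> unselected m n \<mu> w l"
        using m \<mu> by (intro maximal_recursive_tree_imp_unselected[OF _ _ V(1,3)]) auto
      then have "card V \<le> card (unselected m n \<mu> w l)"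
        by (intro card_mono) (auto simp: unselected_def)
      then show ?thesis using V(2) by linarith
    qed
    then have "emeasure (left_law m n w)
        {l \<in> space (left_law m n w). (w, l) \<in> max_tree_event m n ?Q}
      \<le> emeasure (left_law m n w)
        {l \<in> space (left_law m n w). c \<le> real (card (unselected m n \<mu> w l))}"
      by (intro emeasure_mono unselected_measurable) auto
    also note emeasure_left_law_unselected_le[OF m \<mu> pos s c]
    finally show "emeasure (left_law m n w)
        {l \<in> space (left_law m n w). (w, l) \<in> max_tree_event m n ?Q}
      \<le> ennreal (W w (m * \<mu>)) / ennreal (s * real (m * \<mu>))
      + ennreal (W w (m * n + 1)) / ennreal (s * real (m * n + 1))
      + ennreal (1 / c) * (\<Sum>a=1..\<mu>. ennreal (exp (- (s / 6) * ?\<Gamma> a w)))" .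
  qed
  also have "\<dots> = (\<integral>\<^sup>+w. ennreal (W w (m * \<mu>)) \<partial>weight_law m n) / ennreal (s * real (m * \<mu>))
      + (\<integral>\<^sup>+w. ennreal (W w (m * n + 1)) \<partial>weight_law m n) / ennreal (s * real (m * n + 1))
      + ennreal (1 / c) * (\<Sum>a=1..\<mu>. \<integral>\<^sup>+w. ennreal (exp (- (s / 6) * ?\<Gamma> a w)) \<partial>weight_law m n)"
  proof -
    have [measurable]: "(\<lambda>w. ennreal (W w (m * \<mu>))) \<in> borel_measurable (weight_law m n)"
      "(\<lambda>w. ennreal (W w (m * n + 1))) \<in> borel_measurable (weight_law m n)"
      using \<mu>n(1) by (intro measurable_compose[OF mW measurable_ennreal]; linarith)+
    have g: "(\<lambda>w. ennreal (exp (- (s / 6) * ?\<Gamma> a w))) \<in> borel_measurable (weight_law m n)"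
      if "a \<in> {1..\<mu>}" for a
      using m\<Gamma>[OF that] by measurable
    then have [measurable]: "(\<lambda>w. \<Sum>a=1..\<mu>. ennreal (exp (- (s / 6) * ?\<Gamma> a w)))
        \<in> borel_measurable (weight_law m n)"
      by (rule borel_measurable_sum)
    show ?thesis
      by (subst nn_integral_add, measurable, subst nn_integral_add, measurable,
          subst nn_integral_divide, measurable, subst nn_integral_divide, measurable,
          subst nn_integral_cmult, measurable, subst nn_integral_sum[OF g], simp_all only:)
  qed
  also have "(\<Sum>a=1..\<mu>. \<integral>\<^sup>+w. ennreal (exp (- (s / 6) * ?\<Gamma> a w)) \<partial>weight_law m n)
      = (\<Sum>a=1..\<mu>. ennreal ((1 / (1 + s / 6)) ^ m))"
  proof (intro sum.cong refl)
    fix a assume a: "a \<in> {1..\<mu>}"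
    \<comment> \<open>Truncated subtraction would make the block empty for \<open>a = 0\<close>,
      which the range of \<open>a\<close> excludes.\<close>
    have "card {m * (a - 1) + 1..m * a} = m" using a by (cases a) auto
    then show "(\<integral>\<^sup>+w. ennreal (exp (- (s / 6) * ?\<Gamma> a w)) \<partial>weight_law m n)
        = ennreal ((1 / (1 + s / 6)) ^ m)"
      using nn_integral_weight_law_exp_sum[OF block[OF a], of "s / 6"] s by simp
  qed
  also have "(\<integral>\<^sup>+w. ennreal (W w (m * \<mu>)) \<partial>weight_law m n) / ennreal (s * real (m * \<mu>)) = ennreal (1 / s)"
  proof (subst nn_integral_weight_law_W)
    show "m * \<mu> \<le> m * n + 1" using \<mu>n(1) by linarith
  qed (use s m \<mu> in \<open>auto simp: divide_ennreal\<close>)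
  also have "(\<integral>\<^sup>+w. ennreal (W w (m * n + 1)) \<partial>weight_law m n) / ennreal (s * real (m * n + 1)) = ennreal (1 / s)"
    using s by (subst nn_integral_weight_law_W)
      (auto simp: divide_ennreal simp del: of_nat_add of_nat_mult of_nat_Suc)
  also have "ennreal (1 / s) + ennreal (1 / s) + ennreal (1 / c) * (\<Sum>a=1..\<mu>. ennreal ((1 / (1 + s / 6)) ^ m))
      = ennreal (2 / s + real \<mu> / c * (1 / (1 + s / 6)) ^ m)"
    using s c
    by (simp add: ennreal_of_nat_eq_real_of_nat ennreal_mult'[symmetric] ennreal_plus[symmetric] del: ennreal_plus)
  finally have "prob (max_tree_event m n ?Q) \<le> 2 / s + real \<mu> / c * (1 / (1 + s / 6)) ^ m"
    using s c by (subst (asm) emeasure_eq_measure, subst (asm) ennreal_le_iff) auto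
  also have "\<dots> \<le> 2 / s + real \<mu> / c * (6 / s) ^ m"
    using s c by (intro add_left_mono mult_left_mono power_mono) (auto simp: field_simps)
  finally show ?thesis .
qed

section \<open>Passage to the limit\<close>

text \<open>Common limit step for both claims: the threshold \<open>c\<close> is either 1 or
  proportional to \<open>\<mu>\<close>, and only the vanishing of the term in \<open>lim\<close>
  depends on that choice; \<open>2 / s n\<close> vanishes in either case.\<close>

lemma prob_no_max_tree_tendsto_1:
  fixes \<mu> :: "nat \<Rightarrow> nat" and c s :: "nat \<Rightarrow> real"
  assumes m: "1 \<le> m"
    and ev: "eventually (\<lambda>n. 1 \<le> \<mu> n \<and> 2 * \<mu> n \<le> n \<and> 0 < c n) sequentially"
    and s_def: "\<And>n. s n = (real n / real (\<mu> n)) powr (1 / 4)"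
    and s: "filterlim s at_top sequentially"
    and lim: "(\<lambda>n. real (\<mu> n) / c n * (6 / s n) ^ m) \<longlonglongrightarrow> 0"
  shows "(\<lambda>n. \<P>(\<omega> in BR m n. \<not> (\<exists>V E. (V \<subseteq> {1..\<mu> n} \<and> c n \<le> real (card V)) \<and>
    maximal_recursive_tree m n \<omega> V E))) \<longlonglongrightarrow> 1"
proof -
  let ?B = "\<lambda>n. max_tree_event m n (\<lambda>V. V \<subseteq> {1..\<mu> n} \<and> c n \<le> real (card V))"
  have "(\<lambda>n. 2 / s n) \<longlonglongrightarrow> 0"
    using tendsto_divide_0[OF tendsto_const filterlim_at_top_imp_at_infinity[OF s]] by simp
  from tendsto_add[OF this lim]
  have lim0: "(\<lambda>n. 2 / s n + real (\<mu> n) / c n * (6 / s n) ^ m) \<longlonglongrightarrow> 0" by simp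
  have "(\<lambda>n. measure (BR m n) (?B n)) \<longlonglongrightarrow> 0"
  proof (rule tendsto_sandwich[OF _ _ tendsto_const lim0])
    show "\<forall>\<^sub>F n in sequentially. measure (BR m n) (?B n)
        \<le> 2 / s n + real (\<mu> n) / c n * (6 / s n) ^ m"
      using ev
    proof eventually_elim
      case (elim n)
      \<comment> \<open>Here \<open>\<mu> n \<ge> 1\<close> is essential: for
        \<open>\<mu> n = 0\<close> division by zero would give \<open>s n = 0\<close>.\<close>
      have "s n ^ 4 = real n / real (\<mu> n)" "0 < s n"
        using elim by (simp_all add: s_def powr_powr flip: powr_numeral)
      then show ?case using elim m by (intro prob_max_tree_event_le) auto
    qed
  qed auto
  then have "(\<lambda>n. 1 - measure (BR m n) (?B n)) \<longlonglongrightarrow> 1 - 0" by (intro tendsto_intros)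
  moreover have "\<P>(\<omega> in BR m n. \<not> (\<exists>V E. (V \<subseteq> {1..\<mu> n} \<and> c n \<le> real (card V)) \<and>
      maximal_recursive_tree m n \<omega> V E)) = 1 - measure (BR m n) (?B n)" for n
  proof -
    have "{\<omega> \<in> space (BR m n). \<not> (\<exists>V E. (V \<subseteq> {1..\<mu> n} \<and> c n \<le> real (card V)) \<and>
      maximal_recursive_tree m n \<omega> V E)} = space (BR m n) - ?B n"
      unfolding max_tree_event_def by blast
    then show ?thesis
      using prob_space.prob_compl[OF prob_space_BR max_tree_event_measurable] by simp
  qed
  ultimately show ?thesis by simp
qed

theorem theorem4p1:
  fixes m :: nat
  assumes "m \<ge> 1"
  shows
    "(\<forall>\<epsilon>::real. 0 < \<epsilon> \<and> \<epsilon> < real m / (real m + 4) \<longrightarrow>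
        (\<lambda>n. \<P>(\<omega> in BR m n. \<not> (\<exists>V E.
            V \<subseteq> {1..nat \<lfloor>real n powr (real m / (real m + 4) - \<epsilon>)\<rfloor>} \<and>
            maximal_recursive_tree m n \<omega> V E))) \<longlonglongrightarrow> 1) \<and>
     (\<forall>\<mu>::nat \<Rightarrow> nat. filterlim \<mu> at_top sequentially \<and> (\<lambda>n. real (\<mu> n)) \<in> o(\<lambda>n. real n) \<longrightarrow>
        (\<forall>\<kappa>::real. 0 < \<kappa> \<and> \<kappa> < 1 \<longrightarrow>
          (\<lambda>n. \<P>(\<omega> in BR m n. \<not> (\<exists>A. A \<subseteq> {1..\<mu> n} \<and> real (card A) \<ge> \<kappa> * real (\<mu> n) \<and>
              (\<exists>E. maximal_recursive_tree m n \<omega> A E)))) \<longlonglongrightarrow> 1))"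
proof (intro conjI allI impI)
  fix \<epsilon> :: real assume \<epsilon>: "0 < \<epsilon> \<and> \<epsilon> < real m / (real m + 4)"
  define \<alpha> where "\<alpha> = real m / (real m + 4) - \<epsilon>"
  define \<mu> where "\<mu> n = nat \<lfloor>real n powr \<alpha>\<rfloor>" for n :: nat
  define s where "s n = (real n / real (\<mu> n)) powr (1 / 4)" for n
  have "real m / (real m + 4) < 1" by simp
  then have \<alpha>: "0 < \<alpha>" "\<alpha> < 1" using \<epsilon> unfolding \<alpha>_def by linarith+
  have \<mu>1: "1 \<le> \<mu> n" if "1 \<le> n" for n
  proof -
    have "1 \<le> real n powr \<alpha>" using that \<alpha> by (intro ge_one_powr_ge_zero) auto
    then show ?thesis unfolding \<mu>_def by linarith
  qed
  have \<mu>2: "real (\<mu> n) \<le> real n powr \<alpha>" for n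
    unfolding \<mu>_def by simp
  \<comment> \<open>Rounding down in \<open>\<mu>\<close> only enlarges the quotient, so
    \<open>s\<close> is at least its value for the unrounded power.\<close>
  have sge: "real n powr ((1 - \<alpha>) / 4) \<le> s n" if n: "1 \<le> n" for n
  proof -
    have "real n powr (1 - \<alpha>) = real n / real n powr \<alpha>"
      using n by (simp add: powr_diff)
    also have "\<dots> \<le> real n / real (\<mu> n)"
      using n \<mu>1[OF n] \<mu>2[of n] by (intro divide_left_mono) auto
    finally have "(real n powr (1 - \<alpha>)) powr (1 / 4) \<le> s n"
      unfolding s_def by (intro powr_mono2) auto
    then show ?thesis by (simp add: powr_powr)
  qed
  have lim: "filterlim (\<lambda>n. real n powr b) at_top sequentially" if "0 < b" for b
    using that by (intro filterlim_compose[OF real_powr_at_top filterlim_real_sequentially])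
  have ev1: "eventually (\<lambda>n::nat. 1 \<le> n) sequentially" by (rule eventually_ge_at_top)
  have "(\<lambda>n. \<P>(\<omega> in BR m n. \<not> (\<exists>V E. (V \<subseteq> {1..\<mu> n} \<and> 1 \<le> real (card V)) \<and>
    maximal_recursive_tree m n \<omega> V E))) \<longlonglongrightarrow> 1"
  proof (rule prob_no_max_tree_tendsto_1[OF assms _ s_def])
    have "eventually (\<lambda>n. 2 \<le> real n powr (1 - \<alpha>)) sequentially"
      using lim[of "1 - \<alpha>"] \<alpha> by (simp add: filterlim_at_top)
    with ev1 show "eventually (\<lambda>n. 1 \<le> \<mu> n \<and> 2 * \<mu> n \<le> n \<and> (0::real) < 1) sequentially"
    proof eventually_elim
      case (elim n)
      have "2 * real (\<mu> n) \<le> real n powr (1 - \<alpha>) * real n powr \<alpha>"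
        using elim \<mu>2[of n] by (intro mult_mono) auto
      also have "\<dots> = real n" using elim by (simp flip: powr_add)
      finally show ?case using \<mu>1 elim by auto
    qed
    show "filterlim s at_top sequentially"
      using sge \<alpha>
      by (intro filterlim_at_top_mono[OF lim[of "(1 - \<alpha>) / 4"]] eventually_mono[OF ev1]) auto
    \<comment> \<open>This is the exponent of \<open>n\<close> by which \<open>s ^ m\<close> beats
      \<open>\<mu>\<close>: \<open>(1 - \<alpha>) * m / 4 - \<alpha>\<close>. It would be 0 at
      \<open>\<alpha> = m / (m + 4)\<close>, whence the threshold in the first claim.\<close>
    define b where "b = \<epsilon> * (real m + 4) / 4"
    have b: "0 < b" using \<epsilon> by (simp add: b_def)
    have \<alpha>b: "\<alpha> = (1 - \<alpha>) / 4 * real m - b"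
      unfolding b_def \<alpha>_def by (simp add: field_simps)
    have lim0: "(\<lambda>n. 6 ^ m * (1 / real n powr b)) \<longlonglongrightarrow> 0"
      by (intro tendsto_mult_right_zero tendsto_divide_0[OF tendsto_const]
          filterlim_at_top_imp_at_infinity lim b)
    show "(\<lambda>n. real (\<mu> n) / 1 * (6 / s n) ^ m) \<longlonglongrightarrow> 0"
    proof (rule tendsto_sandwich[OF _ _ tendsto_const lim0])
      show "\<forall>\<^sub>F n in sequentially. real (\<mu> n) / 1 * (6 / s n) ^ m \<le> 6 ^ m * (1 / real n powr b)"
        using ev1
      proof eventually_elim
        case (elim n)
        define t where "t = real n powr ((1 - \<alpha>) / 4)"
        have t: "0 < t" "t \<le> s n" using elim sge by (auto simp: t_def)
        have tm: "real n powr \<alpha> = t ^ m / real n powr b"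
          using elim
          by (subst \<alpha>b) (simp add: t_def powr_diff powr_powr flip: powr_realpow)
        have "real (\<mu> n) / 1 * (6 / s n) ^ m \<le> real n powr \<alpha> * (6 / t) ^ m"
          using t \<mu>2[of n] by (simp only: div_by_1) (intro mult_mono power_mono divide_left_mono, auto)
        also have "\<dots> = 6 ^ m * (1 / real n powr b)"
          unfolding tm using t by (simp add: power_divide)
        finally show ?case .
      qed
    qed (auto simp: s_def)
  qed
  \<comment> \<open>Trees are nonempty by definition, so with \<open>c = 1\<close> the cardinality
    condition is automatic.\<close>
  moreover have "(V \<subseteq> {1..\<mu> n} \<and> 1 \<le> real (card V)) \<and> maximal_recursive_tree m n \<omega> V E \<longleftrightarrow>
      V \<subseteq> {1..\<mu> n} \<and> maximal_recursive_tree m n \<omega> V E" for n \<omega> V E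
  proof -
    have "1 \<le> real (card V)" if "V \<subseteq> {1..\<mu> n}" "maximal_recursive_tree m n \<omega> V E"
    proof -
      have "V \<noteq> {}"
        using that(2) by (simp add: maximal_recursive_tree_def recursive_tree_def is_tree_def)
      moreover have "finite V" using that(1) by (rule finite_subset) simp
      ultimately have "0 < card V" by (simp add: card_gt_0_iff)
      then show ?thesis by simp
    qed
    then show ?thesis by blast
  qed
  ultimately show "(\<lambda>n. \<P>(\<omega> in BR m n. \<not> (\<exists>V E.
      V \<subseteq> {1..nat \<lfloor>real n powr (real m / (real m + 4) - \<epsilon>)\<rfloor>} \<and>
      maximal_recursive_tree m n \<omega> V E))) \<longlonglongrightarrow> 1"
    by (simp only: \<mu>_def \<alpha>_def)
next
  fix \<mu> :: "nat \<Rightarrow> nat" and \<kappa> :: real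
  assume \<mu>: "filterlim \<mu> at_top sequentially \<and> (\<lambda>n. real (\<mu> n)) \<in> o(\<lambda>n. real n)"
    and \<kappa>: "0 < \<kappa> \<and> \<kappa> < 1"
  define s where "s n = (real n / real (\<mu> n)) powr (1 / 4)" for n
  have ev1: "eventually (\<lambda>n. 1 \<le> \<mu> n) sequentially" using \<mu> by (auto simp: filterlim_at_top)
  have small: "eventually (\<lambda>n. real (\<mu> n) \<le> e * real n) sequentially" if "0 < e" for e
    using landau_o.smallD[OF conjunct2[OF \<mu>] that] by simp
  have ratio: "filterlim (\<lambda>n. real n / real (\<mu> n)) at_top sequentially"
    unfolding filterlim_at_top_gt[where c = 0]
  proof (intro allI impI)
    fix Z :: real assume Z: "0 < Z"
    have "eventually (\<lambda>n. real (\<mu> n) \<le> 1 / Z * real n) sequentially" using Z by (intro small) simp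
    with ev1 show "eventually (\<lambda>n. Z \<le> real n / real (\<mu> n)) sequentially"
      by eventually_elim (use Z in \<open>simp add: field_simps\<close>)
  qed
  have s: "filterlim s at_top sequentially"
    unfolding s_def by (rule filterlim_compose[OF real_powr_at_top ratio]) simp
  have "(\<lambda>n. \<P>(\<omega> in BR m n. \<not> (\<exists>V E. (V \<subseteq> {1..\<mu> n} \<and> \<kappa> * real (\<mu> n) \<le> real (card V)) \<and>
    maximal_recursive_tree m n \<omega> V E))) \<longlonglongrightarrow> 1"
  proof (rule prob_no_max_tree_tendsto_1[OF assms _ s_def s])
    show "eventually (\<lambda>n. 1 \<le> \<mu> n \<and> 2 * \<mu> n \<le> n \<and> 0 < \<kappa> * real (\<mu> n)) sequentially"
      using ev1 small[of "1 / 2", simplified] by eventually_elim (use \<kappa> in auto)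
    have "(\<lambda>n. 6 / s n) \<longlonglongrightarrow> 0"
      using tendsto_divide_0[OF tendsto_const filterlim_at_top_imp_at_infinity[OF s]] by simp
    then have "(\<lambda>n. 1 / \<kappa> * (6 / s n) ^ m) \<longlonglongrightarrow> 1 / \<kappa> * 0 ^ m" by (intro tendsto_intros)
    \<comment> \<open>The limit \<open>0 ^ m\<close> is 0 because \<open>m \<ge> 1\<close>.\<close>
    then have "(\<lambda>n. 1 / \<kappa> * (6 / s n) ^ m) \<longlonglongrightarrow> 0" using assms by (simp add: power_0_left)
    \<comment> \<open>Cancelling \<open>\<mu> n\<close> is legitimate only once it is positive; for
      \<open>\<mu> n = 0\<close> the quotient is 0 by convention.\<close>
    moreover have "eventually (\<lambda>n. 1 / \<kappa> * (6 / s n) ^ m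
        = real (\<mu> n) / (\<kappa> * real (\<mu> n)) * (6 / s n) ^ m) sequentially"
      using ev1 by eventually_elim simp
    ultimately show "(\<lambda>n. real (\<mu> n) / (\<kappa> * real (\<mu> n)) * (6 / s n) ^ m) \<longlonglongrightarrow> 0"
      by (rule Lim_transform_eventually)
  qed
  then show "(\<lambda>n. \<P>(\<omega> in BR m n. \<not> (\<exists>A. A \<subseteq> {1..\<mu> n} \<and> real (card A) \<ge> \<kappa> * real (\<mu> n) \<and>
      (\<exists>E. maximal_recursive_tree m n \<omega> A E)))) \<longlonglongrightarrow> 1"
    by (simp add: conj_assoc)
qed

end
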